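(* Let $f:\mathbb{R}^n\to\mathbb{R}^n$ be a $d$-demicontractive mapping for some $d\in[0,1)$ with $\mathrm{Fix}(f)\neq\emptyset$, and let $\ell:\mathbb{R}^n\to\mathbb{R}$ be a convex, differentiable, lower semicontinuous and proper function. Then the problem $$\min_{\mathbf{x}\in\mathbb{R}^n}\ \ell(\mathbf{x})\quad\text{s.t. } \mathbf{x}\in\mathrm{Fix}(f)$$ is a convex minimization problem, i.e., it is the minimization of a convex function over a convex subset of $\mathbb{R}^n$.
   Context: $\|\cdot\|$ is the Euclidean norm on $\mathbb{R}^n$. For $T:\mathbb{R}^n\to\mathbb{R}^n$, $\mathrm{Fix}(T)=\{\mathbf{x}\in\mathbb{R}^n: T(\mathbf{x})=\mathbf{x}\}$. The mapping $T$ is $d$-demicontractive, $d\in[0,1)$, if for all $\mathbf{x}\in\mathbb{R}^n$ and all $\mathbf{z}\in\mathrm{Fix}(T)$, $$\|T(\mathbf{x})-\mathbf{z}\|^2\le\|\mathbf{x}-\mathbf{z}\|^2+d\,\|T(\mathbf{x})-\mathbf{x}\|^2 .$$ *)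

theory Defs
  imports "HOL-Analysis.Analysis"
begin

definition Fix :: "('a \<Rightarrow> 'a) \<Rightarrow> 'a set" where
  "Fix T = {x. T x = x}"

(* The range condition on d is kept separate and imposed where the notion is used. *)
definition demicontractive :: "real \<Rightarrow> (real ^ 'n \<Rightarrow> real ^ 'n) \<Rightarrow> bool" where
  "demicontractive d T \<longleftrightarrow>
     (\<forall>x. \<forall>z \<in> Fix T.
        (norm (T x - z))\<^sup>2 \<le> (norm (x - z))\<^sup>2 + d * (norm (T x - x))\<^sup>2)"

(* Lower semicontinuity and properness are the notions for extended-real-valued
   functions; a real-valued function is embedded through ereal. *)
definition lower_semicontinuous :: "('a::topological_space \<Rightarrow> ereal) \<Rightarrow> bool" where
  "lower_semicontinuous g \<longleftrightarrow> (\<forall>x. \<forall>c < g x. \<forall>\<^sub>F y in nhds x. c < g y)"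

definition proper_fun :: "('a \<Rightarrow> ereal) \<Rightarrow> bool" where
  "proper_fun g \<longleftrightarrow> (\<forall>x. g x \<noteq> -\<infinity>) \<and> (\<exists>x. g x \<noteq> \<infinity>)"

(* The problem: minimize l x subject to x \<in> C.  The objective is required to be
   convex on the whole space, not merely on the feasible set. *)
definition convex_minimization_problem ::
    "('a::real_vector \<Rightarrow> real) \<Rightarrow> 'a set \<Rightarrow> bool" where
  "convex_minimization_problem l C \<longleftrightarrow> convex_on UNIV l \<and> convex C"

end

(* With w = f x - x, demicontractivity says that every fixed point z satisfies
   (1 - d) |w|^2 <= 2 w . (z - x), an affine constraint on z.  For x on the segment between
   two fixed points, the corresponding convex combination gives (1 - d) |w|^2 <= 0. *)
theory Submission
  imports Defs
begin

lemma demicontractive_halfspace: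
  assumes "demicontractive d f" and "z \<in> Fix f"
  shows "(1 - d) * (norm (f x - x))\<^sup>2 \<le> 2 * ((f x - x) \<bullet> (z - x))"
proof -
  have "(norm (f x - z))\<^sup>2 \<le> (norm (x - z))\<^sup>2 + d * (norm (f x - x))\<^sup>2"
    using assms by (auto simp: demicontractive_def)
  \<comment> \<open>Expand the square of \<open>f x - z = (f x - x) - (z - x)\<close>. The term
    \<open>(norm (x - z))\<^sup>2\<close> also occurs in the demicontractive bound and cancels, so
    \<open>z\<close> survives only linearly.\<close>
  moreover have "(norm (f x - z))\<^sup>2 =
      (norm (f x - x))\<^sup>2 + (norm (x - z))\<^sup>2 - 2 * ((f x - x) \<bullet> (z - x))"
    by (simp add: power2_norm_eq_inner inner_diff_left inner_diff_right inner_commute)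
  ultimately show ?thesis
    by (simp add: algebra_simps)
qed

lemma demicontractive_convex_Fix:
  assumes "demicontractive d f" and "d < 1"
  shows "convex (Fix f)"
proof (rule convexI)
  fix a b and u v :: real
  assume ab: "a \<in> Fix f" "b \<in> Fix f" and uv: "0 \<le> u" "0 \<le> v" "u + v = 1"
  define x where "x = u *\<^sub>R a + v *\<^sub>R b"
  let ?w = "f x - x" and ?c = "(1 - d) * (norm (f x - x))\<^sup>2"
  \<comment> \<open>Splitting \<open>?c\<close> by the weights lets the bounds at \<open>a\<close>
    and \<open>b\<close> be averaged.\<close>
  have "?c = u * ?c + v * ?c"
    using uv by (simp flip: distrib_right)
  also have "\<dots> \<le> u * (2 * (?w \<bullet> (a - x))) + v * (2 * (?w \<bullet> (b - x)))"
    using ab uv assms by (intro add_mono mult_left_mono demicontractive_halfspace)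
  also have "\<dots> = 2 * (?w \<bullet> (u *\<^sub>R (a - x) + v *\<^sub>R (b - x)))"
    by (simp add: inner_add_right)
  \<comment> \<open>As \<open>u + v = 1\<close>, this vector is zero: \<open>x\<close> is the
    weighted mean of \<open>a\<close> and \<open>b\<close>.\<close>
  also have "u *\<^sub>R (a - x) + v *\<^sub>R (b - x) = x - (u + v) *\<^sub>R x"
    by (simp add: x_def algebra_simps)
  finally have "?c \<le> 0"
    using uv by simp
  \<comment> \<open>The strict bound makes the factor \<open>1 - d\<close> positive, so the squared
    norm itself is at most 0.\<close>
  with \<open>d < 1\<close> have "norm ?w = 0"
    by (simp add: mult_le_0_iff)
  then show "u *\<^sub>R a + v *\<^sub>R b \<in> Fix f"
    by (simp add: Fix_def x_def)
qed

theorem theorem4p2: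
  fixes f :: "real ^ 'n \<Rightarrow> real ^ 'n"
    and l :: "real ^ 'n \<Rightarrow> real"
    and d :: real
  assumes "0 \<le> d" and "d < 1"
    and "demicontractive d f"
    and "Fix f \<noteq> {}"
    and "convex_on UNIV l"
    and "\<forall>x. l differentiable (at x)"
    and "lower_semicontinuous (\<lambda>x. ereal (l x))"
    and "proper_fun (\<lambda>x. ereal (l x))"
  shows "convex_minimization_problem l (Fix f)"
  using assms demicontractive_convex_Fix by (auto simp: convex_minimization_problem_def)

end
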